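(* Let $\mathrm{k}$ be a field and $K$ a commutative field extension of $\mathrm{k}$. Let $A$ and $B$ be nonempty finite subsets of $K^{\ast}=K\setminus\{0\}$ and let $\alpha$ be a positive real number with $\dim_{\mathrm{k}}(AB)\leq\alpha\dim_{\mathrm{k}}(A)$. Then there exists a subset $X\subseteq\mathrm{k}\langle A\rangle$ with $\mathrm{k}\langle X\rangle\neq\{0\}$ such that for every positive integer $n$, \[\dim_{\mathrm{k}}(XB^{n})\leq\alpha^{n}\dim_{\mathrm{k}}(X).\] In particular, $\dim_{\mathrm{k}}(A^{2})\leq\alpha\dim_{\mathrm{k}}(A)$ implies $\dim_{\mathrm{k}}(A^{n})\leq\alpha^{n}\dim_{\mathrm{k}}(A)$ for every positive integer $n$.
   Context: For $Y\subseteq K$, $\mathrm{k}\langle Y\rangle$ is the $\mathrm{k}$-linear span of $Y$ and $\dim_{\mathrm{k}}(Y)$ its dimension over $\mathrm{k}$. Products of sets are Minkowski products, $B^{n}=B\cdots B$ ($n$ factors). *)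

theory Defs
  imports Complex_Main "HOL-Library.Set_Algebras"
begin

text \<open>
  A field extension of \<open>k\<close> by \<open>K\<close> is given by the embedding \<open>\<iota>\<close> of \<open>k\<close> into \<open>K\<close>, with arbitrary
  field types \<open>'k\<close> and \<open>'a\<close> for \<open>k\<close> and \<open>K\<close>. Injectivity of \<open>\<iota>\<close> follows from the axioms, since
  \<open>'k\<close> is a field and \<open>\<iota> 1 = 1 \<noteq> 0\<close>.
\<close>

locale field_extension =
  fixes \<iota> :: "'k::field \<Rightarrow> 'a::field"
  assumes emb_add: "\<iota> (c + d) = \<iota> c + \<iota> d"
    and emb_mult: "\<iota> (c * d) = \<iota> c * \<iota> d"
    and emb_one: "\<iota> 1 = 1"

sublocale field_extension \<subseteq> vector_space "\<lambda>c x. \<iota> c * x"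
  by unfold_locales (simp_all add: emb_add emb_mult emb_one algebra_simps)

text \<open>
  The library dimension of a set is that of its span; it is a natural number, with
  value \<open>0\<close> for an infinite-dimensional span. All sets measured below have
  finite-dimensional spans. Minkowski products and powers of sets are those of
  \<open>Set_Algebras\<close>.
\<close>

abbreviation ext_span :: "('k::field \<Rightarrow> 'a::field) \<Rightarrow> 'a set \<Rightarrow> 'a set"
  where "ext_span \<iota> \<equiv> module.span (\<lambda>c x. \<iota> c * x)"

abbreviation ext_dim :: "('k::field \<Rightarrow> 'a::field) \<Rightarrow> 'a set \<Rightarrow> nat"
  where "ext_dim \<iota> \<equiv> vector_space.dim (\<lambda>c x. \<iota> c * x)"

end

theory Submission
  imports Defs
begin

text \<open>
  Petridis' argument, with cardinalities replaced by dimensions. Among the nonzero subspaces of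
  \<open>k\<langle>A\<rangle>\<close> let \<open>V\<close> minimise \<open>K = dim (V B) / dim V\<close>, so that \<open>K \<le> \<alpha>\<close>. Then
  \<open>dim (V C B) \<le> K dim (V C)\<close> for every finite \<open>C\<close>, by induction on \<open>C\<close>: when \<open>c\<close> is added to
  \<open>C\<close>, the dimension of \<open>V C\<close> grows by \<open>dim V - dim Z\<close>, where \<open>Z = {v \<in> V. v c \<in> k\<langle>V C\<rangle>}\<close>, while
  that of \<open>V C B\<close> grows by at most \<open>dim (V B) - dim (Z B) \<le> K dim V - K dim Z\<close>. Taking
  \<open>C = B\<^sup>n\<close> and inducting on \<open>n\<close> shows that \<open>X = V\<close> works. For \<open>B = A\<close>, any nonzero \<open>v \<in> V\<close> yields
  \<open>dim (A\<^sup>n) = dim (v A\<^sup>n) \<le> dim (V A\<^sup>n)\<close>.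
\<close>

section \<open>Finitely spanned sets and the modular law for dimension\<close>

context vector_space
begin

text \<open>The ambient space may be infinite-dimensional, and there \<open>dim\<close> defaults to
  0 and is not monotone. This predicate marks the sets on which \<open>dim\<close> is the true
  dimension.\<close>

definition finitely_spanned :: "'b set \<Rightarrow> bool"
  where "finitely_spanned S \<longleftrightarrow> (\<exists>F. finite F \<and> S \<subseteq> span F)"

end

text \<open>
  Reopening the context makes the names refer to the local versions again, and not to the instances
  exported by the unqualified interpretation of \<open>vector_space\<close> for real vector spaces.
\<close>

context vector_space
begin

lemma finitely_spanned_finite: "finite S \<Longrightarrow> finitely_spanned S"
  using finitely_spanned_def span_superset by blast

lemma finitely_spanned_subset: "finitely_spanned T \<Longrightarrow> S \<subseteq> T \<Longrightarrow> finitely_spanned S"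
  unfolding finitely_spanned_def by blast

lemma finitely_spanned_span: "finitely_spanned S \<Longrightarrow> finitely_spanned (span S)"
  unfolding finitely_spanned_def by (meson span_minimal subspace_span)

lemma finitely_spanned_independent_finite:
  "finitely_spanned S \<Longrightarrow> independent B \<Longrightarrow> B \<subseteq> S \<Longrightarrow> finite B"
  unfolding finitely_spanned_def using independent_span_bound by blast

lemma dim_mono_finitely_spanned:
  assumes "finitely_spanned T" "S \<subseteq> span T"
  shows "dim S \<le> dim T"
proof -
  obtain B where B: "B \<subseteq> T" "independent B" "T \<subseteq> span B" "card B = dim T"
    by (rule basis_exists)
  have "finite B"
    using finitely_spanned_independent_finite B assms(1) by blast
  moreover have "S \<subseteq> span B"
    using assms(2) B(3) span_minimal subspace_span by blast
  ultimately show ?thesis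
    using dim_le_card B(4) by metis
qed

lemma dim_pos_finitely_spanned:
  assumes "finitely_spanned S" "x \<in> S" "x \<noteq> 0"
  shows "dim S > 0"
proof -
  have "dim {x} = 1"
    using dim_eq_card_independent[of "{x}"] assms(3) by simp
  moreover have "dim {x} \<le> dim S"
    using assms(2) by (intro dim_mono_finitely_spanned[OF assms(1)]) (simp add: span_base)
  ultimately show ?thesis by simp
qed

lemma dim_zero_subspace: "dim {0} = 0"
  using dim_span_eq_card_independent[OF independent_empty] by simp

text \<open>If \<open>a\<close> in \<open>P\<close> equals \<open>x + y\<close> with
  \<open>x\<close> spanned by \<open>P - {a}\<close> and \<open>y\<close> spanned by
  \<open>Q\<close>, then \<open>y = a - x\<close> lies in both spans and vanishes, so
  \<open>a\<close> depends on the rest of \<open>P\<close>. The argument is run once in each order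
  of the two sets.\<close>

lemma independent_Un_if_span_Int_trivial:
  assumes S: "independent S" and T: "independent T" and ST: "span S \<inter> span T \<subseteq> {0}"
  shows "independent (S \<union> T)"
proof -
  have half: "a \<notin> span (P \<union> Q - {a})"
    if P: "independent P" and Q: "independent Q" and PQ: "span P \<inter> span Q \<subseteq> {0}" and a: "a \<in> P"
    for P Q a
  proof
    assume "a \<in> span (P \<union> Q - {a})"
    then have "a \<in> span ((P - {a}) \<union> Q)"
      using span_mono[of "P \<union> Q - {a}" "(P - {a}) \<union> Q"] by blast
    then obtain x y where xy: "a = x + y" "x \<in> span (P - {a})" "y \<in> span Q"
      unfolding span_Un by blast
    have "x \<in> span P"
      using xy(2) span_mono[of "P - {a}" P] by blast
    then have "y \<in> span P"
      using span_diff[OF span_base[OF a]] xy(1) by (metis add_diff_cancel_left')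
    then have "y = 0"
      using xy(3) PQ by blast
    then show False
      using xy(1,2) P a dependent_def by auto
  qed
  show ?thesis
    unfolding dependent_def
    using half[OF S T ST] half[OF T S] ST by (auto simp: Un_commute Int_commute)
qed

text \<open>The coordinates of a common vector with respect to \<open>B\<close> are supported in
  \<open>A\<close> and also in \<open>B - A\<close>, so all of them vanish.\<close>

lemma independent_span_Int_span_Diff:
  assumes B: "independent B" and A: "A \<subseteq> B"
  shows "span A \<inter> span (B - A) \<subseteq> {0}"
proof
  fix x assume x: "x \<in> span A \<inter> span (B - A)"
  have xB: "x \<in> span B"
    using x A span_mono by blast
  have "representation B x = representation A x"
    using representation_extend[OF B, of x A] x A by blast
  moreover have "representation B x = representation (B - A) x"
    using representation_extend[OF B, of x "B - A"] x by blast
  ultimately have "representation B x b = 0" for b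
    using representation_ne_zero[of A x b] representation_ne_zero[of "B - A" x b] by auto
  then show "x \<in> {0}"
    using sum_nonzero_representation_eq[OF B xB] by simp
qed

text \<open>Since \<open>dim\<close> sees only the span, the union stands for the sum of the two
  subspaces. A basis \<open>B\<close> of the intersection is extended to bases \<open>P\<close> of
  \<open>U\<close> and \<open>Q\<close> of \<open>W\<close>; then \<open>P\<close> together with
  \<open>Q - B\<close> is a basis of the sum.\<close>

lemma dim_Un_plus_dim_Int:
  assumes U: "subspace U" "finitely_spanned U" and W: "subspace W" "finitely_spanned W"
  shows "dim (U \<union> W) + dim (U \<inter> W) = dim U + dim W"
proof -
  obtain B where B: "B \<subseteq> U \<inter> W" "independent B" "U \<inter> W \<subseteq> span B"
    by (rule maximal_independent_subset)
  obtain P where P: "B \<subseteq> P" "P \<subseteq> U" "independent P" "U \<subseteq> span P"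
    using maximal_independent_subset_extend[of B U] B by blast
  obtain Q where Q: "B \<subseteq> Q" "Q \<subseteq> W" "independent Q" "W \<subseteq> span Q"
    using maximal_independent_subset_extend[of B W] B by blast
  have spanP: "span P = U"
    using P U(1) span_minimal by blast
  have "span (Q - B) \<subseteq> W"
    using Q W(1) by (meson Diff_subset span_minimal subset_trans)
  then have triv: "span P \<inter> span (Q - B) \<subseteq> {0}"
    using spanP B(3) independent_span_Int_span_Diff[OF Q(3,1)] by blast
  have "independent (Q - B)"
    using Q(3) independent_mono by blast
  then have ind: "independent (P \<union> (Q - B))"
    using independent_Un_if_span_Int_trivial[OF P(3) _ triv] by blast
  have disj: "P \<inter> (Q - B) = {}"
    using triv P(3) dependent_zero span_superset[of P] span_superset[of "Q - B"] by blast
  have fin: "finite P" "finite Q"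
    using P Q U(2) W(2) finitely_spanned_independent_finite by blast+
  have eq: "P \<union> (Q - B) = P \<union> Q"
    using P(1) by blast
  have "U \<union> W \<subseteq> span (P \<union> Q)"
    using P(4) Q(4) span_mono[of P "P \<union> Q"] span_mono[of Q "P \<union> Q"] by blast
  then have "dim (U \<union> W) = card (P \<union> (Q - B))"
    using basis_card_eq_dim[of "P \<union> (Q - B)" "U \<union> W"] P(2) Q(2) ind unfolding eq
    by (metis Un_mono)
  also have "\<dots> = card P + (card Q - card B)"
    using card_Un_disjoint[OF _ _ disj] fin card_Diff_subset[of B Q] Q(1) finite_subset by auto
  finally have "dim (U \<union> W) = card P + (card Q - card B)" .
  moreover have "card B \<le> card Q"
    using Q(1) fin(2) card_mono by blast
  moreover have "card B = dim (U \<inter> W)" "card P = dim U" "card Q = dim W"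
    using basis_card_eq_dim B P Q by blast+
  ultimately show ?thesis by linarith
qed

end

section \<open>Spans of Minkowski products and multiplication by a scalar of the big field\<close>

context field_extension
begin

lemma mult_mem_span_times:
  assumes x: "x \<in> span S" and y: "y \<in> span T"
  shows "x * y \<in> span (S * T)"
proof -
  have right: "s * y \<in> span (S * T)" if s: "s \<in> S" for s
    using y
  proof (induction rule: span_induct_alt)
    case base
    then show ?case by (simp add: span_zero)
  next
    case (step c t z)
    have "\<iota> c * (s * t) + s * z \<in> span (S * T)"
      using step s by (intro span_add[OF span_scale[OF span_base]] set_times_intro)
    then show ?case by (simp add: algebra_simps)
  qed
  show ?thesis
    using x
  proof (induction rule: span_induct_alt)
    case base
    then show ?case by (simp add: span_zero)
  next
    case (step c s z)
    have "\<iota> c * (s * y) + z * y \<in> span (S * T)"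
      using step right by (intro span_add span_scale) auto
    then show ?case by (simp add: algebra_simps)
  qed
qed

lemma span_times_span_subset: "span S * span T \<subseteq> span (S * T)"
  using mult_mem_span_times by (auto elim: set_times_elim)

lemma finitely_spanned_times:
  assumes "finitely_spanned S" "finitely_spanned T"
  shows "finitely_spanned (S * T)"
proof -
  obtain F G where "finite F" "S \<subseteq> span F" "finite G" "T \<subseteq> span G"
    using assms finitely_spanned_def by auto
  then have "finite (F * G)" "S * T \<subseteq> span (F * G)"
    using span_times_span_subset[of F G] set_times_mono2[of S "span F" T "span G"]
    by (blast intro: finite_set_times)+
  then show ?thesis
    unfolding finitely_spanned_def by blast
qed

lemma mult_right_linear: "module_hom (\<lambda>c x. \<iota> c * x) (\<lambda>c x. \<iota> c * x) (\<lambda>x. x * c)"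
  by unfold_locales (simp_all add: algebra_simps emb_add emb_mult emb_one)

lemma span_mult_right: "span ((\<lambda>x. x * c) ` S) = (\<lambda>x. x * c) ` span S"
  by (rule module_hom.span_image[OF mult_right_linear])

lemma subspace_mult_right: "subspace S \<Longrightarrow> subspace ((\<lambda>x. x * c) ` S)"
  by (metis span_eq_iff span_mult_right)

lemma finitely_spanned_mult_right: "finitely_spanned S \<Longrightarrow> finitely_spanned ((\<lambda>x. x * c) ` S)"
  unfolding finitely_spanned_def
  by (metis finite_imageI image_mono span_mult_right)

lemma dim_mult_right:
  assumes "c \<noteq> 0"
  shows "dim ((\<lambda>x. x * c) ` S) = dim S"
proof -
  obtain B where B: "B \<subseteq> S" "independent B" "S \<subseteq> span B" "card B = dim S"
    by (rule basis_exists)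
  have inj: "inj_on (\<lambda>x. x * c) T" for T
    using assms by (simp add: inj_on_def)
  have "independent ((\<lambda>x. x * c) ` B)"
    using module_hom.independent_injective_image[OF mult_right_linear B(2) inj] .
  moreover have "(\<lambda>x. x * c) ` S \<subseteq> span ((\<lambda>x. x * c) ` B)"
    using B(3) span_mult_right by blast
  ultimately have "dim ((\<lambda>x. x * c) ` S) = card ((\<lambda>x. x * c) ` B)"
    using basis_card_eq_dim B(1) by (metis image_mono)
  then show ?thesis
    using B(4) card_image[OF inj] by metis
qed

text \<open>Adding one element to \<open>C\<close> adds one translate of \<open>span S\<close>; both
  pieces appear as subspaces so that \<open>dim_Un_plus_dim_Int\<close> applies to them.\<close>

lemma span_times_insert:
  "span (S * insert c C) = span ((\<lambda>x. x * c) ` span S \<union> span (S * C))"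
proof -
  have "S * insert c C = (\<lambda>x. x * c) ` S \<union> S * C"
    by (auto simp: set_times_image)
  moreover have "span (P \<union> Q) = span (span P \<union> span Q)" for P Q
    by (simp add: span_Un span_span)
  ultimately show ?thesis
    by (metis span_mult_right)
qed

section \<open>Petridis' inequality for a subspace of minimal ratio\<close>

lemma dim_times_le_of_minimal_ratio:
  assumes V: "subspace V" "finitely_spanned V" and B: "finite B"
    and VB: "real (dim (V * B)) = K * real (dim V)"
    and min: "\<And>Z. subspace Z \<Longrightarrow> Z \<subseteq> V \<Longrightarrow> K * real (dim Z) \<le> real (dim (Z * B))"
    and C: "finite C" "0 \<notin> C"
  shows "real (dim (V * B * C)) \<le> K * real (dim (V * C))"
  using C
proof (induction C rule: finite_induct)
  case empty
  have "S * {} = {}" for S :: "'a set"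
    by (auto simp: set_times_image)
  moreover have "dim {} = 0"
    using dim_le_card'[of "{}"] by simp
  ultimately show ?case by simp
next
  case (insert c C)
  let ?m = "\<lambda>x. x * c"
  let ?W = "span (V * C)" and ?W' = "span (V * B * C)"
  define Z where "Z = {v \<in> V. v * c \<in> ?W}"
  \<comment> \<open>Multiplication by a nonzero \<open>c\<close> is injective, so passing to images
    under \<open>?m\<close> preserves dimensions.\<close>
  have c: "c \<noteq> 0"
    using insert.prems by auto
  have fB: "finitely_spanned B" and fC: "finitely_spanned C"
    using B insert.hyps finitely_spanned_finite by auto
  have Z: "subspace Z" "Z \<subseteq> V"
    unfolding Z_def subspace_def
    using subspace_0[OF V(1)] subspace_add[OF V(1)] subspace_scale[OF V(1)]
      span_add[of _ "V * C"] span_scale[of _ "V * C"] span_zero[of "V * C"]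
    by (auto simp: distrib_right mult.assoc)
  \<comment> \<open>\<open>Z\<close> is chosen so that its image under \<open>?m\<close> is exactly
    the intersection in the modular law, which makes this an equality.\<close>
  have "dim (V * insert c C) + dim (?m ` Z) = dim (?m ` V) + dim ?W"
  proof -
    have "?m ` Z = ?m ` V \<inter> ?W"
      unfolding Z_def by auto
    moreover have "dim (V * insert c C) = dim (?m ` V \<union> ?W)"
      using span_times_insert[of V c C] V(1) by (metis span_eq_iff span_eq_dim)
    ultimately show ?thesis
      using dim_Un_plus_dim_Int[of "?m ` V" ?W] V fC
      by (simp add: subspace_mult_right finitely_spanned_mult_right finitely_spanned_span
          finitely_spanned_times)
  qed
  then have eq: "real (dim (V * insert c C)) = real (dim V) + real (dim (V * C)) - real (dim Z)"
    using c by (simp add: dim_mult_right)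
  let ?U' = "?m ` span (V * B)"
  have f': "finitely_spanned ?U'" "finitely_spanned ?W'"
    using V fB fC
    by (simp_all add: finitely_spanned_mult_right finitely_spanned_span finitely_spanned_times)
  have "dim (V * B * insert c C) + dim (?U' \<inter> ?W') = dim ?U' + dim ?W'"
    using dim_Un_plus_dim_Int[OF _ f'(1) _ f'(2)] span_eq_dim[OF span_times_insert[of "V * B" c C]]
    by (simp add: subspace_mult_right)
  \<comment> \<open>Only a lower bound for the second intersection is needed: for \<open>z\<close>
    in \<open>Z\<close>, commutativity turns \<open>z * b * c\<close> into
    \<open>(z * c) * b\<close>, and \<open>z * c\<close> is already in
    \<open>span (V * C)\<close>.\<close>
  moreover have "dim (?m ` (Z * B)) \<le> dim (?U' \<inter> ?W')"
  proof (rule dim_mono_finitely_spanned)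
    show "finitely_spanned (?U' \<inter> ?W')"
      using f'(1) finitely_spanned_subset by blast
    have "z * b * c \<in> ?U' \<inter> ?W'" if z: "z \<in> Z" and b: "b \<in> B" for z b
    proof -
      have "z * c * b \<in> span (V * C * B)"
        using z span_base[OF b] mult_mem_span_times[of "z * c" "V * C" b B]
        unfolding Z_def by simp
      then have "z * b * c \<in> ?W'"
        by (simp add: mult_ac)
      moreover have "z * b \<in> span (V * B)"
        using z b Z(2) span_base by blast
      ultimately show ?thesis by blast
    qed
    then show "?m ` (Z * B) \<subseteq> span (?U' \<inter> ?W')"
      using span_superset by (fastforce elim: set_times_elim)
  qed
  ultimately have "real (dim (V * B * insert c C))
      \<le> real (dim (V * B)) + real (dim (V * B * C)) - real (dim (Z * B))"
    using c by (simp add: dim_mult_right)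
  \<comment> \<open>The three terms are bounded by the ratio of \<open>V\<close>, the induction
    hypothesis for \<open>C\<close>, and minimality tested on \<open>Z\<close>; the result is
    \<open>K\<close> times the right side of \<open>eq\<close>.\<close>
  also have "\<dots> \<le> K * real (dim V) + K * real (dim (V * C)) - K * real (dim Z)"
    using VB min[OF Z] insert by auto
  finally show ?case
    by (simp only: eq right_diff_distrib distrib_left)
qed

text \<open>There may be infinitely many subspaces of \<open>span A\<close>, but the ratio
  \<open>r\<close> takes finitely many values: its numerator is at most \<open>dim (A * B)\<close>
  and its denominator at most \<open>dim A\<close>. Hence a minimum is attained.\<close>

lemma minimal_ratio_subspace:
  assumes A: "finite A" "a \<in> A" "a \<noteq> 0" and B: "finite B"
    and AB: "real (dim (A * B)) \<le> \<alpha> * real (dim A)"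
  obtains V K where "subspace V" "V \<subseteq> span A" "V \<noteq> {0}" "0 \<le> K" "K \<le> \<alpha>"
    "real (dim (V * B)) = K * real (dim V)"
    "\<forall>Z. subspace Z \<longrightarrow> Z \<subseteq> V \<longrightarrow> K * real (dim Z) \<le> real (dim (Z * B))"
proof -
  define \<V> where "\<V> = {V. subspace V \<and> V \<subseteq> span A \<and> V \<noteq> {0}}"
  define r where "r V = real (dim (V * B)) / real (dim V)" for V
  have fA: "finitely_spanned A" and fB: "finitely_spanned B"
    using A B finitely_spanned_finite by auto
  have dim_pos: "dim V > 0" if V: "V \<in> \<V>" for V
  proof -
    obtain v where "v \<in> V" "v \<noteq> 0"
      using V subspace_0[of V] unfolding \<V>_def by blast
    moreover have "finitely_spanned V"
      using finitely_spanned_subset[OF finitely_spanned_span[OF fA]] V unfolding \<V>_def by blast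
    ultimately show ?thesis
      using dim_pos_finitely_spanned by blast
  qed
  have spanAB: "span A * B \<subseteq> span (A * B)"
    using span_times_span_subset[of A B] set_times_mono2[OF order_refl span_superset[of B]] by blast
  have "r ` \<V> \<subseteq> (\<lambda>(m, n). real m / real n) ` ({..dim (A * B)} \<times> {..dim A})"
  proof
    fix q assume "q \<in> r ` \<V>"
    then obtain V where V: "V \<subseteq> span A" "q = r V"
      unfolding \<V>_def by blast
    have "V * B \<subseteq> span (A * B)"
      using set_times_mono2[OF V(1) order_refl[of B]] spanAB by blast
    then have "dim (V * B) \<le> dim (A * B)" "dim V \<le> dim A"
      using V fA fB by (auto intro!: dim_mono_finitely_spanned finitely_spanned_times)
    then show "q \<in> (\<lambda>(m, n). real m / real n) ` ({..dim (A * B)} \<times> {..dim A})"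
      using V(2) unfolding r_def by force
  qed
  then have fin: "finite (r ` \<V>)"
    by (rule finite_subset) simp
  have "a \<in> span A"
    using A(2) by (rule span_base)
  then have spanA: "span A \<in> \<V>"
    using A(3) unfolding \<V>_def by auto
  then obtain V where V: "V \<in> \<V>" and rV: "r V = Min (r ` \<V>)"
    using Min_in[OF fin] by fastforce
  have min: "r V \<le> r Z" if "Z \<in> \<V>" for Z
    using rV fin that by simp
  show thesis
  proof (rule that[of V "r V"])
    show "subspace V" "V \<subseteq> span A" "V \<noteq> {0}"
      using V unfolding \<V>_def by auto
    show "0 \<le> r V"
      unfolding r_def by simp
    \<comment> \<open>\<open>span A\<close> is itself a competitor, so its ratio bounds the minimum
      by \<alpha>.\<close>
    have "dim (span A * B) \<le> dim (A * B)"
      using spanAB fA fB by (auto intro!: dim_mono_finitely_spanned finitely_spanned_times)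
    then have "real (dim (span A * B)) \<le> \<alpha> * real (dim A)"
      using AB by linarith
    then have "r (span A) \<le> \<alpha>"
      using dim_pos[OF spanA] unfolding r_def by (simp add: divide_le_eq)
    then show "r V \<le> \<alpha>"
      using min[OF spanA] by simp
    show "real (dim (V * B)) = r V * real (dim V)"
      using dim_pos[OF V] unfolding r_def by simp
    have "r V * real (dim Z) \<le> real (dim (Z * B))" if Z: "subspace Z" "Z \<subseteq> V" for Z
    proof (cases "Z = {0}")
      case True
      then show ?thesis by (simp add: dim_zero_subspace)
    next
      case False
      then have "Z \<in> \<V>"
        using Z V unfolding \<V>_def by auto
      then show ?thesis
        using min[of Z] dim_pos[of Z] unfolding r_def[of Z] by (simp add: le_divide_eq)
    qed
    then show "\<forall>Z. subspace Z \<longrightarrow> Z \<subseteq> V \<longrightarrow> r V * real (dim Z) \<le> real (dim (Z * B))"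
      by blast
  qed
qed

section \<open>Iteration over the powers of \<open>B\<close>\<close>

lemma finite_power_set: "finite (B :: 'a set) \<Longrightarrow> finite (B ^ n)"
  by (induction n) (auto intro: finite_set_times)

lemma zero_notin_power_set: "0 \<notin> (B :: 'a set) \<Longrightarrow> 0 \<notin> B ^ n"
  by (induction n) (auto elim: set_times_elim)

text \<open>The minimiser is chosen before \<open>n\<close>, so one \<open>V\<close> serves all
  exponents. Each step regroups \<open>V * B ^ Suc n\<close> as \<open>(V * B) * B ^ n\<close> and
  applies Petridis' inequality with \<open>C = B ^ n\<close>.\<close>

theorem pluennecke_dim:
  assumes A: "finite A" "a \<in> A" "a \<noteq> 0" and B: "finite B" "0 \<notin> B"
    and AB: "real (dim (A * B)) \<le> \<alpha> * real (dim A)"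
  obtains V where "subspace V" "V \<subseteq> span A" "V \<noteq> {0}"
    "\<And>n. real (dim (V * B ^ n)) \<le> \<alpha> ^ n * real (dim V)"
proof -
  obtain V K where V: "subspace V" "V \<subseteq> span A" "V \<noteq> {0}" and K: "0 \<le> K" "K \<le> \<alpha>"
    and VB: "real (dim (V * B)) = K * real (dim V)"
    and min: "\<forall>Z. subspace Z \<longrightarrow> Z \<subseteq> V \<longrightarrow> K * real (dim Z) \<le> real (dim (Z * B))"
    by (rule minimal_ratio_subspace[OF A B(1) AB])
  have fV: "finitely_spanned V"
    using V(2) A(1) finitely_spanned_finite finitely_spanned_span finitely_spanned_subset by blast
  have bound: "real (dim (V * B ^ n)) \<le> K ^ n * real (dim V)" for n
  proof (induction n)
    case 0
    then show ?case by (simp only: power_0 mult_1_right mult_1_left order_refl)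
  next
    case (Suc n)
    have "real (dim (V * B ^ Suc n)) = real (dim (V * B * B ^ n))"
      by (simp add: mult.assoc)
    also have "\<dots> \<le> K * real (dim (V * B ^ n))"
      using dim_times_le_of_minimal_ratio[OF V(1) fV B(1) VB min[rule_format]]
        finite_power_set[OF B(1)] zero_notin_power_set[OF B(2)] by blast
    also have "\<dots> \<le> K * (K ^ n * real (dim V))"
      using Suc K(1) mult_left_mono by blast
    finally show ?case by (simp add: mult.assoc)
  qed
  \<comment> \<open>The induction runs with the exact ratio \<open>K\<close>; only now is it
    replaced by \<alpha>, using \<open>0 \<le> K \<le> \<alpha>\<close>.\<close>
  have "real (dim (V * B ^ n)) \<le> \<alpha> ^ n * real (dim V)" for n
    using bound[of n] mult_right_mono[OF power_mono[OF K(2,1)], of "real (dim V)" n] by simp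
  then show thesis
    using that V by blast
qed

corollary pluennecke_dim_power:
  assumes A: "finite A" "A \<noteq> {}" "0 \<notin> A"
    and AA: "real (dim (A ^ 2)) \<le> \<alpha> * real (dim A)" and \<alpha>: "\<alpha> > 0"
  shows "real (dim (A ^ n)) \<le> \<alpha> ^ n * real (dim A)"
proof -
  obtain a where a: "a \<in> A" "a \<noteq> 0"
    using A by (metis ex_in_conv)
  obtain V where V: "subspace V" "V \<subseteq> span A" "V \<noteq> {0}"
    "real (dim (V * A ^ n)) \<le> \<alpha> ^ n * real (dim V)"
    using pluennecke_dim[OF A(1) a A(1,3)] AA by (metis power2_eq_square)
  obtain v where v: "v \<in> V" "v \<noteq> 0"
    using V(1,3) subspace_0 by blast
  have fA: "finitely_spanned A"
    using A(1) by (rule finitely_spanned_finite)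
  have fV: "finitely_spanned V"
    using V(2) fA finitely_spanned_span finitely_spanned_subset by blast
  have "dim (A ^ n) = dim ((\<lambda>x. x * v) ` (A ^ n))"
    using v(2) by (simp add: dim_mult_right)
  also have "\<dots> \<le> dim (V * A ^ n)"
  proof (rule dim_mono_finitely_spanned)
    show "finitely_spanned (V * A ^ n)"
      by (intro finitely_spanned_times fV finitely_spanned_finite finite_power_set A(1))
    show "(\<lambda>x. x * v) ` (A ^ n) \<subseteq> span (V * A ^ n)"
      using v(1) by (auto simp: mult.commute[of _ v] intro!: span_base)
  qed
  finally have "real (dim (A ^ n)) \<le> \<alpha> ^ n * real (dim V)"
    using V(4) by linarith
  \<comment> \<open>\<open>V\<close> lies in \<open>span A\<close>, so its dimension is at most
    \<open>dim A\<close>.\<close>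
  also have "\<dots> \<le> \<alpha> ^ n * real (dim A)"
    using dim_mono_finitely_spanned[OF fA V(2)] \<alpha> by (simp add: mult_left_mono)
  finally show ?thesis .
qed

end

theorem theorem3p3:
  fixes \<iota> :: "'k::field \<Rightarrow> 'a::field"
    and A :: "'a set"
    and \<alpha> :: real
  assumes ext: "field_extension \<iota>"
    and A: "finite A" "A \<noteq> {}" "A \<subseteq> UNIV - {0}"
    and \<alpha>: "\<alpha> > 0"
  shows "(\<forall>B :: 'a set. finite B \<longrightarrow> B \<noteq> {} \<longrightarrow> B \<subseteq> UNIV - {0} \<longrightarrow>
            real (ext_dim \<iota> (A * B)) \<le> \<alpha> * real (ext_dim \<iota> A) \<longrightarrow>
            (\<exists>X. X \<subseteq> ext_span \<iota> A \<and> ext_span \<iota> X \<noteq> {0} \<and>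
                 (\<forall>n::nat. n > 0 \<longrightarrow>
                    real (ext_dim \<iota> (X * B ^ n)) \<le> \<alpha> ^ n * real (ext_dim \<iota> X)))) \<and>
         (real (ext_dim \<iota> (A ^ 2)) \<le> \<alpha> * real (ext_dim \<iota> A) \<longrightarrow>
            (\<forall>n::nat. n > 0 \<longrightarrow>
               real (ext_dim \<iota> (A ^ n)) \<le> \<alpha> ^ n * real (ext_dim \<iota> A)))"
proof -
  interpret field_extension \<iota>
    by (rule ext)
  obtain a where a: "a \<in> A" "a \<noteq> 0"
    using A by blast
  have "\<exists>X. X \<subseteq> span A \<and> span X \<noteq> {0} \<and>
      (\<forall>n::nat. n > 0 \<longrightarrow> real (dim (X * B ^ n)) \<le> \<alpha> ^ n * real (dim X))"
    if B: "finite B" "B \<subseteq> UNIV - {0}" and AB: "real (dim (A * B)) \<le> \<alpha> * real (dim A)" for B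
  proof -
    have "0 \<notin> B"
      using B(2) by blast
    then obtain V where "subspace V" "V \<subseteq> span A" "V \<noteq> {0}"
      "\<And>n. real (dim (V * B ^ n)) \<le> \<alpha> ^ n * real (dim V)"
      using pluennecke_dim[OF A(1) a B(1) _ AB] by blast
    then show ?thesis
      \<comment> \<open>As a subspace, \<open>V\<close> is its own span, so \<open>X = V\<close> has
        nonzero span.\<close>
      by (metis span_eq_iff)
  qed
  moreover have "0 \<notin> A"
    using A(3) by blast
  ultimately show ?thesis
    using pluennecke_dim_power[OF A(1,2) _ _ \<alpha>] by blast
qed

end
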